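(* Let $\varphi$ be a realizable LTL formula over input variables $I$ and output variables $O$, and let $A = (\Sigma_I \times \Sigma_O, Q, \delta, q_0, F)$ be a nondeterministic Büchi automaton with $L(A) = L(\varphi)$ in which every state and transition lies on an accepting run. Let $X \subseteq O$ be a maximal dependent set in $\varphi$ and $Y = I \cup (O \setminus X)$. Let $A'$ be the NBA over $\Sigma_Y = \Sigma_I \times \Sigma_{O \setminus X}$ with the same states, initial state and accepting states as $A$, and with $q' \in \delta'(q,\tau)$ iff there is $\sigma' \in \Sigma_X$ with $q' \in \delta(q,(\tau,\sigma'))$. Let $T_Y$ be a transducer with input alphabet $\Sigma_I$ and output alphabet $\Sigma_{O\setminus X}$ realizing $L(A')$ (i.e., every word over $\Sigma_Y$ it generates lies in $L(A')$). Let $T_X$ be the transducer with input alphabet $\Sigma_Y$, output alphabet $\Sigma_X \cup \{\bot\}$, state set $2^Q$, initial state $\{q_0\}$, transition function $\delta^X(U,(\sigma_I,\sigma)) = \{q' \mid \exists q \in U\ \exists \sigma' \in \Sigma_X: q' \in \delta(q,(\sigma_I,\sigma,\sigma'))\}$, and output function $\lambda^X(U,(\sigma_I,\sigma))$ equal to the unique $\sigma_X \in \Sigma_X$ with $\delta^X(U,(\sigma_I,\sigma)) = \{q' \mid \exists q \in U: q' \in \delta(q,(\sigma_I,\sigma,\sigma_X))\}$ when $\delta^X(U,(\sigma_I,\sigma)) \neq \emptyset$, and $\bot$ otherwise. Let $T$ be the composition in which, on each input letter $\sigma_I$, $T_Y$ produces $\sigma \in \Sigma_{O \setminus X}$, then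 $T_X$ reads $(\sigma_I,\sigma)$ and produces $\sigma_X$, and $T$ outputs $(\sigma,\sigma_X) \in \Sigma_O$. Then $T$ realizes $\varphi$: every word in $(\Sigma_I \times \Sigma_O)^\omega$ generated by $T$ belongs to $L(\varphi)$.
   Context: $\Sigma_Z = 2^Z$ (assignments to $Z$); letters of $\Sigma_I \times \Sigma_O$ are written $(\sigma_I,\sigma,\sigma')$ with $\sigma \in \Sigma_{O\setminus X}$, $\sigma' \in \Sigma_X$. A transducer (Mealy machine) $(\Sigma_{in},\Sigma_{out},S,s_0,\delta_T,\lambda)$ has deterministic $\delta_T : S \times \Sigma_{in} \to S$ and output $\lambda : S \times \Sigma_{in} \to \Sigma_{out}$; on input $a_0a_1\cdots$ it produces the word $(a_0,b_0)(a_1,b_1)\cdots$ with $b_j = \lambda(s_j,a_j)$, $s_{j+1} = \delta_T(s_j,a_j)$. $\varphi$ is realizable if there is a strategy $f : \Sigma_I^* \to \Sigma_O$ (equivalently a transducer) such that every word it generates is in $L(\varphi)$. For an infinite word $w$, $w[0,i] = w_0\cdots w_i$, $w[0,-1]$ is empty, and $a.Z$ is the restriction of letter $a$ to $Z$. $X$ is dependent in $\varphi$ if for all $w,w' \in L(\varphi)$, $i \ge 0$: $w[0,i-1]=w'[0,i-1]$ and $w_i.(V\setminus X) = w'_i.(V\setminus X)$ imply $w_i.X = w'_i.X$, where $V = I\cup O$; $X$ is a maximal dependent set if it is dependent in $\varphi$ and no $X' \subseteq O$ strictly containing $X$ is dependent in $\varphi$. (Under these hypotheses the $\sigma_X$ in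 the definition of $\lambda^X$ is unique on reachable states.) *)

theory Defs
  imports Main "HOL-Library.Omega_Words_Fun"
begin

text \<open>
  An assignment to a finite set \<open>Z\<close> of Boolean variables is the set of variables it makes true,
  so the alphabet over \<open>Z\<close> is \<open>Pow Z\<close>. Letters over the input and output variables are pairs in
  \<open>Pow I \<times> Pow Ou\<close>; for \<open>X \<subseteq> Ou\<close> a letter \<open>\<sigma>\<^sub>O \<in> Pow Ou\<close> is identified with the pair of its
  restrictions to \<open>Ou - X\<close> and \<open>X\<close>, that is \<open>\<sigma>\<^sub>O = \<sigma> \<union> \<sigma>'\<close> with \<open>\<sigma> \<in> Pow (Ou - X)\<close> and
  \<open>\<sigma>' \<in> Pow X\<close>.
\<close>

subsection \<open>LTL\<close>

datatype 'v ltl =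
    LTrue
  | LAtom 'v
  | LNot "'v ltl"
  | LOr "'v ltl" "'v ltl"
  | LNext "'v ltl"
  | LUntil "'v ltl" "'v ltl"

primrec ltl_sat :: "'v set word \<Rightarrow> 'v ltl \<Rightarrow> bool" where
  "ltl_sat w LTrue \<longleftrightarrow> True"
| "ltl_sat w (LAtom p) \<longleftrightarrow> p \<in> w 0"
| "ltl_sat w (LNot f) \<longleftrightarrow> \<not> ltl_sat w f"
| "ltl_sat w (LOr f g) \<longleftrightarrow> ltl_sat w f \<or> ltl_sat w g"
| "ltl_sat w (LNext f) \<longleftrightarrow> ltl_sat (suffix 1 w) f"
| "ltl_sat w (LUntil f g) \<longleftrightarrow>
     (\<exists>k. ltl_sat (suffix k w) g \<and> (\<forall>j<k. ltl_sat (suffix j w) f))"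

definition restrict_letter :: "'v set \<times> 'v set \<Rightarrow> 'v set \<Rightarrow> 'v set" where
  "restrict_letter a Z = (fst a \<union> snd a) \<inter> Z"

definition ltl_lang :: "'v set \<Rightarrow> 'v set \<Rightarrow> 'v ltl \<Rightarrow> ('v set \<times> 'v set) word set" where
  "ltl_lang I Ou \<phi> =
     {w. range w \<subseteq> Pow I \<times> Pow Ou \<and> ltl_sat (\<lambda>i. fst (w i) \<union> snd (w i)) \<phi>}"

text \<open>
  The output at step \<open>j\<close> may depend on the inputs at steps \<open>0, \<dots>, j\<close>, as for Mealy machines;
  the value of a strategy on the empty list is never used.
\<close>

definition realizable :: "'v set \<Rightarrow> 'v set \<Rightarrow> 'v ltl \<Rightarrow> bool" where
  "realizable I Ou \<phi> \<longleftrightarrow>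
     (\<exists>f :: 'v set list \<Rightarrow> 'v set.
        (\<forall>u \<in> lists (Pow I). f u \<in> Pow Ou) \<and>
        (\<forall>\<alpha>. range \<alpha> \<subseteq> Pow I \<longrightarrow> (\<lambda>j. (\<alpha> j, f (prefix (Suc j) \<alpha>))) \<in> ltl_lang I Ou \<phi>))"

subsection \<open>Dependent sets\<close>

definition dependent_in :: "'v set \<Rightarrow> 'v set \<Rightarrow> 'v ltl \<Rightarrow> 'v set \<Rightarrow> bool" where
  "dependent_in I Ou \<phi> X \<longleftrightarrow>
     (\<forall>w \<in> ltl_lang I Ou \<phi>. \<forall>w' \<in> ltl_lang I Ou \<phi>. \<forall>i.
        prefix i w = prefix i w' \<and>
        restrict_letter (w i) ((I \<union> Ou) - X) = restrict_letter (w' i) ((I \<union> Ou) - X) \<longrightarrow>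
        restrict_letter (w i) X = restrict_letter (w' i) X)"

definition maximal_dependent :: "'v set \<Rightarrow> 'v set \<Rightarrow> 'v ltl \<Rightarrow> 'v set \<Rightarrow> bool" where
  "maximal_dependent I Ou \<phi> X \<longleftrightarrow>
     X \<subseteq> Ou \<and> dependent_in I Ou \<phi> X \<and>
     \<not> (\<exists>X'. X \<subset> X' \<and> X' \<subseteq> Ou \<and> dependent_in I Ou \<phi> X')"

subsection \<open>Nondeterministic Buechi automata\<close>

record ('a, 'q) nba =
  nba_alph :: "'a set"
  nba_states :: "'q set"
  nba_delta :: "'q \<Rightarrow> 'a \<Rightarrow> 'q set"
  nba_init :: 'q
  nba_acc :: "'q set"

definition wf_nba :: "('a, 'q) nba \<Rightarrow> bool" where
  "wf_nba A \<longleftrightarrow>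
     finite (nba_alph A) \<and> finite (nba_states A) \<and>
     nba_init A \<in> nba_states A \<and> nba_acc A \<subseteq> nba_states A \<and>
     (\<forall>q \<in> nba_states A. \<forall>a \<in> nba_alph A. nba_delta A q a \<subseteq> nba_states A)"

definition accepting_run :: "('a, 'q) nba \<Rightarrow> 'a word \<Rightarrow> 'q word \<Rightarrow> bool" where
  "accepting_run A w r \<longleftrightarrow>
     range w \<subseteq> nba_alph A \<and>
     r 0 = nba_init A \<and> (\<forall>i. r (Suc i) \<in> nba_delta A (r i) (w i)) \<and>
     limit r \<inter> nba_acc A \<noteq> {}"

definition nba_lang :: "('a, 'q) nba \<Rightarrow> 'a word set" where
  "nba_lang A = {w. \<exists>r. accepting_run A w r}"

definition trim_nba :: "('a, 'q) nba \<Rightarrow> bool" where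
  "trim_nba A \<longleftrightarrow>
     (\<forall>q \<in> nba_states A. \<exists>w r i. accepting_run A w r \<and> r i = q) \<and>
     (\<forall>q \<in> nba_states A. \<forall>a \<in> nba_alph A. \<forall>q' \<in> nba_delta A q a.
        \<exists>w r i. accepting_run A w r \<and> r i = q \<and> w i = a \<and> r (Suc i) = q')"

definition project_nba ::
    "'v set \<Rightarrow> 'v set \<Rightarrow> 'v set \<Rightarrow> ('v set \<times> 'v set, 'q) nba \<Rightarrow> ('v set \<times> 'v set, 'q) nba" where
  "project_nba I Ou X A =
     \<lparr> nba_alph = Pow I \<times> Pow (Ou - X),
       nba_states = nba_states A,
       nba_delta = (\<lambda>q (\<sigma>I, \<sigma>). {q'. \<exists>\<sigma>' \<in> Pow X. q' \<in> nba_delta A q (\<sigma>I, \<sigma> \<union> \<sigma>')}),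
       nba_init = nba_init A,
       nba_acc = nba_acc A \<rparr>"

subsection \<open>Transducers\<close>

record ('a, 'b, 's) transducer =
  td_in :: "'a set"
  td_out :: "'b set"
  td_states :: "'s set"
  td_init :: 's
  td_delta :: "'s \<Rightarrow> 'a \<Rightarrow> 's"
  td_lambda :: "'s \<Rightarrow> 'a \<Rightarrow> 'b"

definition wf_transducer :: "('a, 'b, 's) transducer \<Rightarrow> bool" where
  "wf_transducer T \<longleftrightarrow>
     td_init T \<in> td_states T \<and>
     (\<forall>s \<in> td_states T. \<forall>a \<in> td_in T. td_delta T s a \<in> td_states T \<and> td_lambda T s a \<in> td_out T)"

primrec td_run :: "('a, 'b, 's) transducer \<Rightarrow> 'a word \<Rightarrow> 's word" where
  "td_run T \<alpha> 0 = td_init T"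
| "td_run T \<alpha> (Suc j) = td_delta T (td_run T \<alpha> j) (\<alpha> j)"

definition td_word :: "('a, 'b, 's) transducer \<Rightarrow> 'a word \<Rightarrow> ('a \<times> 'b) word" where
  "td_word T \<alpha> = (\<lambda>j. (\<alpha> j, td_lambda T (td_run T \<alpha> j) (\<alpha> j)))"

definition realizes :: "('a, 'b, 's) transducer \<Rightarrow> ('a \<times> 'b) word set \<Rightarrow> bool" where
  "realizes T L \<longleftrightarrow> (\<forall>\<alpha>. range \<alpha> \<subseteq> td_in T \<longrightarrow> td_word T \<alpha> \<in> L)"

subsection \<open>The subset-construction transducer and the composition\<close>

definition deltaX ::
    "'v set \<Rightarrow> ('v set \<times> 'v set, 'q) nba \<Rightarrow> 'q set \<Rightarrow> 'v set \<times> 'v set \<Rightarrow> 'q set" where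
  "deltaX X A U = (\<lambda>(\<sigma>I, \<sigma>). {q'. \<exists>q \<in> U. \<exists>\<sigma>' \<in> Pow X. q' \<in> nba_delta A q (\<sigma>I, \<sigma> \<union> \<sigma>')})"

text \<open>
  \<open>None\<close> plays the role of \<open>\<bottom>\<close>. On states that are unreachable in the composition the definite
  description may fail to denote; its value is then unspecified (it need not lie in \<open>Pow X\<close>).
\<close>

definition lambdaX ::
    "'v set \<Rightarrow> ('v set \<times> 'v set, 'q) nba \<Rightarrow> 'q set \<Rightarrow> 'v set \<times> 'v set \<Rightarrow> 'v set option" where
  "lambdaX X A U = (\<lambda>(\<sigma>I, \<sigma>).
     if deltaX X A U (\<sigma>I, \<sigma>) \<noteq> {}
     then Some (THE \<sigma>X. \<sigma>X \<in> Pow X \<and>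
            deltaX X A U (\<sigma>I, \<sigma>) = {q'. \<exists>q \<in> U. q' \<in> nba_delta A q (\<sigma>I, \<sigma> \<union> \<sigma>X)})
     else None)"

definition transducerX ::
    "'v set \<Rightarrow> 'v set \<Rightarrow> 'v set \<Rightarrow> ('v set \<times> 'v set, 'q) nba \<Rightarrow>
     ('v set \<times> 'v set, 'v set option, 'q set) transducer" where
  "transducerX I Ou X A =
     \<lparr> td_in = Pow I \<times> Pow (Ou - X),
       td_out = Some ` Pow X \<union> {None},
       td_states = Pow (nba_states A),
       td_init = {nba_init A},
       td_delta = deltaX X A,
       td_lambda = lambdaX X A \<rparr>"

text \<open>
  The composed output \<open>(\<sigma>, \<sigma>\<^sub>X)\<close> is the output letter \<open>\<sigma> \<union> \<sigma>\<^sub>X\<close>. If the second transducer emits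
  \<open>\<bottom>\<close>, there is no such letter and the composition emits \<open>\<bottom>\<close> too.
\<close>

definition compose_td ::
    "'v set \<Rightarrow> ('v set, 'v set, 's) transducer \<Rightarrow>
     ('v set \<times> 'v set, 'v set option, 't) transducer \<Rightarrow>
     ('v set, 'v set option, 's \<times> 't) transducer" where
  "compose_td Ou TY TX =
     \<lparr> td_in = td_in TY,
       td_out = Some ` Pow Ou \<union> {None},
       td_states = td_states TY \<times> td_states TX,
       td_init = (td_init TY, td_init TX),
       td_delta = (\<lambda>(s, U) \<sigma>I.
         (td_delta TY s \<sigma>I, td_delta TX U (\<sigma>I, td_lambda TY s \<sigma>I))),
       td_lambda = (\<lambda>(s, U) \<sigma>I.
         map_option (\<lambda>\<sigma>X. td_lambda TY s \<sigma>I \<union> \<sigma>X)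
           (td_lambda TX U (\<sigma>I, td_lambda TY s \<sigma>I))) \<rparr>"

text \<open>
  The words of \<open>L\<close>, viewed as words whose output alphabet additionally contains \<open>\<bottom>\<close>. A transducer
  realizing this language never emits \<open>\<bottom>\<close>.
\<close>

definition without_bot :: "('a \<times> 'b) word set \<Rightarrow> ('a \<times> 'b option) word set" where
  "without_bot L = (\<lambda>w. map_prod id Some \<circ> w) ` L"

end

theory Submission
  imports Defs
begin

text \<open>
  A word over the reduced alphabet accepted by the projected automaton lifts to a word \<open>w\<close> of
  \<open>L(\<phi>)\<close>. The subset construction only tracks states reachable on prefixes of \<open>w\<close>: if some
  reachable state had a transition whose \<open>X\<close>-part differs from that of \<open>w\<close>, then, the automaton
  being trim, this transition would extend to a second word of \<open>L(\<phi>)\<close> that agrees with \<open>w\<close> up to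
  the \<open>X\<close>-part of that letter, contradicting dependency. Hence the second transducer reproduces
  exactly the \<open>X\<close>-part of \<open>w\<close>.
\<close>

text \<open>The subset run of \<open>A\<close> over the full alphabet, where the
  \<open>X\<close>-parts of the letters are known. It is the yardstick for the state of
  \<open>transducerX\<close>, which has to guess them.\<close>

primrec reach :: "('a, 'q) nba \<Rightarrow> 'a word \<Rightarrow> nat \<Rightarrow> 'q set" where
  "reach A w 0 = {nba_init A}"
| "reach A w (Suc j) = (\<Union>q \<in> reach A w j. nba_delta A q (w j))"

lemma reach_path:
  assumes "q \<in> reach A w j"
  obtains \<rho> where "\<rho> 0 = nba_init A" "\<And>k. k < j \<Longrightarrow> \<rho> (Suc k) \<in> nba_delta A (\<rho> k) (w k)" "\<rho> j = q"
proof -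
  have "\<exists>\<rho>. \<rho> 0 = nba_init A \<and> (\<forall>k<j. \<rho> (Suc k) \<in> nba_delta A (\<rho> k) (w k)) \<and> \<rho> j = q"
    using assms
  proof (induction j arbitrary: q)
    case 0
    then show ?case by auto
  next
    case (Suc j)
    then obtain p where p: "p \<in> reach A w j" "q \<in> nba_delta A p (w j)" by auto
    with Suc.IH obtain \<rho> where \<rho>: "\<rho> 0 = nba_init A"
      "\<forall>k<j. \<rho> (Suc k) \<in> nba_delta A (\<rho> k) (w k)" "\<rho> j = p" by blast
    show ?case
      using p \<rho> by (intro exI[of _ "\<rho>(Suc j := q)"]) (auto simp: less_Suc_eq)
  qed
  then show thesis using that by blast
qed

lemma reach_subset_states:
  assumes "wf_nba A" "range w \<subseteq> nba_alph A"
  shows "reach A w j \<subseteq> nba_states A"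
proof (induction j)
  case 0
  then show ?case using assms(1) by (simp add: wf_nba_def)
next
  case (Suc j)
  moreover have "w j \<in> nba_alph A" using assms(2) by auto
  ultimately show ?case using assms(1) by (auto simp: wf_nba_def subset_iff)
qed

lemma accepting_run_in_reach:
  assumes "accepting_run A w r"
  shows "r j \<in> reach A w j"
  using assms by (induction j) (auto simp: accepting_run_def)

text \<open>Buechi acceptance depends only on the tail of a run, so the part of \<open>r\<close>
  before position \<open>i\<close> can be exchanged for any finite path from the initial state to
  \<open>r i\<close>. The positions \<open>i\<close> and \<open>j\<close> need not agree.\<close>

lemma accepting_run_splice:
  assumes run: "accepting_run A w' r" and alph: "range w \<subseteq> nba_alph A"
    and reach: "r i \<in> reach A w j"
  obtains \<rho> where "accepting_run A (prefix j w \<frown> suffix i w') \<rho>"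
proof -
  from reach obtain \<rho> where \<rho>: "\<rho> 0 = nba_init A"
    "\<And>k. k < j \<Longrightarrow> \<rho> (Suc k) \<in> nba_delta A (\<rho> k) (w k)" "\<rho> j = r i"
    by (rule reach_path) blast
  let ?r = "prefix j \<rho> \<frown> suffix i r" and ?w = "prefix j w \<frown> suffix i w'"
  \<comment> \<open>The two descriptions of \<open>?r\<close> overlap at the seam
    \<open>k = j\<close>, because \<open>\<rho> j = r i\<close>; hence the transition into position
    \<open>j\<close> is still one of \<open>\<rho>\<close>.\<close>
  have r_le: "?r k = \<rho> k" if "k \<le> j" for k
    using that \<rho>(3) by (cases "k = j") (auto simp: conc_def)
  have r_ge: "?r k = r (i + (k - j))" if "k \<ge> j" for k
    using that by (simp add: conc_def)
  have step: "?r (Suc k) \<in> nba_delta A (?r k) (?w k)" for k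
  proof (cases "k < j")
    case True
    then show ?thesis using \<rho>(2)[OF True] by (simp add: r_le)
  next
    case False
    then have "?w k = w' (i + (k - j))" by (simp add: conc_def)
    moreover have "Suc k - j = Suc (k - j)" using False by simp
    ultimately show ?thesis
      using run False by (simp add: r_ge accepting_run_def)
  qed
  have "range ?w \<subseteq> nba_alph A"
    using alph run by (auto simp: conc_def accepting_run_def)
  moreover have "?r 0 = nba_init A" using \<rho>(1) r_le by simp
  ultimately have "accepting_run A ?w ?r"
    using step run by (simp add: accepting_run_def)
  then show thesis by (rule that)
qed

text \<open>Trimness puts the transition from \<open>q\<close> to \<open>q'\<close> on some
  accepting run, though at an arbitrary position \<open>i\<close>. Splicing the tail of that run
  onto a path to \<open>q\<close> labelled by \<open>w\<close> moves it to position \<open>j\<close>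
  and keeps the prefix of \<open>w\<close>.\<close>

lemma trim_reach_extension:
  assumes "wf_nba A" "trim_nba A" "range w \<subseteq> nba_alph A"
    and "q \<in> reach A w j" "a \<in> nba_alph A" "q' \<in> nba_delta A q a"
  obtains w' where "w' \<in> nba_lang A" "prefix j w' = prefix j w" "w' j = a"
proof -
  have "q \<in> nba_states A" using reach_subset_states assms(1,3,4) by blast
  with assms(2,5,6) obtain v r i where v: "accepting_run A v r" "r i = q" "v i = a"
    unfolding trim_nba_def by blast
  with assms(3,4) obtain \<rho> where "accepting_run A (prefix j w \<frown> suffix i v) \<rho>"
    using accepting_run_splice by metis
  then have "prefix j w \<frown> suffix i v \<in> nba_lang A" by (auto simp: nba_lang_def)
  moreover have "prefix j (prefix j w \<frown> suffix i v) = prefix j w" by simp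
  moreover have "(prefix j w \<frown> suffix i v) j = a" using v(3) by (simp add: conc_def)
  ultimately show thesis by (rule that)
qed

text \<open>\<open>restrict_letter\<close> merges the input and output halves of a letter. As
  \<open>X\<close> is disjoint from both \<open>I\<close> and \<open>Ou - X\<close>, restricting to
  \<open>X\<close> recovers exactly the \<open>X\<close>-part, and the rest is common to both
  letters.\<close>

lemma dependent_letter_unique:
  assumes dep: "dependent_in I Ou \<phi> X" and "X \<subseteq> Ou" "I \<inter> Ou = {}"
    and w: "w \<in> ltl_lang I Ou \<phi>" and w': "w' \<in> ltl_lang I Ou \<phi>"
    and pre: "prefix j w' = prefix j w"
    and j: "w j = (\<sigma>\<^sub>I, \<sigma> \<union> \<sigma>\<^sub>X)" "w' j = (\<sigma>\<^sub>I, \<sigma> \<union> \<sigma>\<^sub>X')"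
    and sub: "\<sigma>\<^sub>I \<subseteq> I" "\<sigma> \<subseteq> Ou - X" "\<sigma>\<^sub>X \<subseteq> X" "\<sigma>\<^sub>X' \<subseteq> X"
  shows "\<sigma>\<^sub>X' = \<sigma>\<^sub>X"
proof -
  have "restrict_letter (w j) ((I \<union> Ou) - X) = restrict_letter (w' j) ((I \<union> Ou) - X)"
    using j sub by (auto simp: restrict_letter_def)
  then have "restrict_letter (w j) X = restrict_letter (w' j) X"
    using dep w w' pre unfolding dependent_in_def by metis
  moreover have "restrict_letter (w j) X = \<sigma>\<^sub>X" "restrict_letter (w' j) X = \<sigma>\<^sub>X'"
    using j sub assms(2,3) by (auto simp: restrict_letter_def)
  ultimately show ?thesis by simp
qed

text \<open>Each projected transition hides some \<open>X\<close>-part; choosing one per step makes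
  the same state sequence an accepting run of \<open>A\<close>.\<close>

lemma project_nba_lift:
  assumes "u \<in> nba_lang (project_nba I Ou X A)" "nba_alph A = Pow I \<times> Pow Ou" "X \<subseteq> Ou"
  obtains x where "\<And>j. x j \<subseteq> X" "(\<lambda>j. (fst (u j), snd (u j) \<union> x j)) \<in> nba_lang A"
proof -
  from assms(1) obtain r where r: "accepting_run (project_nba I Ou X A) u r"
    by (auto simp: nba_lang_def)
  have "\<exists>\<sigma>' \<in> Pow X. r (Suc j) \<in> nba_delta A (r j) (fst (u j), snd (u j) \<union> \<sigma>')" for j
    using r by (auto simp: accepting_run_def project_nba_def case_prod_beta)
  then obtain x where x: "\<And>j. x j \<in> Pow X"
    "\<And>j. r (Suc j) \<in> nba_delta A (r j) (fst (u j), snd (u j) \<union> x j)" by metis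
  have letter: "u j \<in> Pow I \<times> Pow (Ou - X)" for j
    using r by (auto simp: accepting_run_def project_nba_def)
  have "(fst (u j), snd (u j) \<union> x j) \<in> nba_alph A" for j
    using letter[of j] x(1)[of j] assms(2,3) by (cases "u j") (auto simp: subset_iff)
  then have "accepting_run A (\<lambda>j. (fst (u j), snd (u j) \<union> x j)) r"
    using r x(2) by (auto simp: accepting_run_def project_nba_def)
  with x(1) show thesis using that by (auto simp: nba_lang_def)
qed

text \<open>One step of the invariant that \<open>transducerX\<close> follows
  \<open>reach A w\<close>: by \<open>uniq\<close>, the quantifier over \<open>X\<close>-parts in
  \<open>deltaX\<close> ranges in effect over \<open>\<sigma>\<^sub>X\<close> alone.\<close>

lemma transducerX_step:
  assumes "wf_nba A" "trim_nba A" "nba_alph A = Pow I \<times> Pow Ou"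
    and lang: "nba_lang A = ltl_lang I Ou \<phi>"
    and "dependent_in I Ou \<phi> X" "X \<subseteq> Ou" "I \<inter> Ou = {}"
    and w: "w \<in> nba_lang A" and j: "w j = (\<sigma>\<^sub>I, \<sigma> \<union> \<sigma>\<^sub>X)"
    and sub: "\<sigma>\<^sub>I \<subseteq> I" "\<sigma> \<subseteq> Ou - X" "\<sigma>\<^sub>X \<subseteq> X"
  shows "deltaX X A (reach A w j) (\<sigma>\<^sub>I, \<sigma>) = reach A w (Suc j)"
    and "lambdaX X A (reach A w j) (\<sigma>\<^sub>I, \<sigma>) = Some \<sigma>\<^sub>X"
proof -
  from w obtain r where r: "accepting_run A w r" by (auto simp: nba_lang_def)
  then have alph: "range w \<subseteq> nba_alph A" by (simp add: accepting_run_def)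
  have uniq: "\<tau> = \<sigma>\<^sub>X"
    if q: "q \<in> reach A w j" and q': "q' \<in> nba_delta A q (\<sigma>\<^sub>I, \<sigma> \<union> \<tau>)" and \<tau>: "\<tau> \<subseteq> X" for q q' \<tau>
  proof -
    have "(\<sigma>\<^sub>I, \<sigma> \<union> \<tau>) \<in> nba_alph A" using assms(3,6) sub \<tau> by auto
    with assms(1,2) alph q q' obtain w' where "w' \<in> nba_lang A" "prefix j w' = prefix j w"
      "w' j = (\<sigma>\<^sub>I, \<sigma> \<union> \<tau>)"
      using trim_reach_extension by metis
    then show ?thesis
      using dependent_letter_unique[OF assms(5-7), of w w' j] w lang j sub \<tau> by metis
  qed
  show delta: "deltaX X A (reach A w j) (\<sigma>\<^sub>I, \<sigma>) = reach A w (Suc j)"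
  proof (intro equalityI subsetI)
    fix q' assume "q' \<in> deltaX X A (reach A w j) (\<sigma>\<^sub>I, \<sigma>)"
    then obtain q \<tau> where "q \<in> reach A w j" "\<tau> \<subseteq> X" "q' \<in> nba_delta A q (\<sigma>\<^sub>I, \<sigma> \<union> \<tau>)"
      by (auto simp: deltaX_def)
    with uniq[of q q' \<tau>] j show "q' \<in> reach A w (Suc j)" by auto
  next
    fix q' assume "q' \<in> reach A w (Suc j)"
    with sub(3) j show "q' \<in> deltaX X A (reach A w j) (\<sigma>\<^sub>I, \<sigma>)"
      by (auto simp: deltaX_def)
  qed
  \<comment> \<open>Nonemptiness serves twice: it excludes the output \<open>None\<close>, and it
    gives any competing \<open>\<tau>\<close> in the definite description a transition to which
    \<open>uniq\<close> applies.\<close>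
  have nonempty: "r (Suc j) \<in> reach A w (Suc j)" by (rule accepting_run_in_reach[OF r])
  have "(THE \<tau>. \<tau> \<in> Pow X \<and>
      reach A w (Suc j) = {q'. \<exists>q \<in> reach A w j. q' \<in> nba_delta A q (\<sigma>\<^sub>I, \<sigma> \<union> \<tau>)}) = \<sigma>\<^sub>X"
  proof (rule the_equality)
    show "\<sigma>\<^sub>X \<in> Pow X \<and>
      reach A w (Suc j) = {q'. \<exists>q \<in> reach A w j. q' \<in> nba_delta A q (\<sigma>\<^sub>I, \<sigma> \<union> \<sigma>\<^sub>X)}"
      using sub(3) j by auto
  next
    fix \<tau>
    assume "\<tau> \<in> Pow X \<and>
      reach A w (Suc j) = {q'. \<exists>q \<in> reach A w j. q' \<in> nba_delta A q (\<sigma>\<^sub>I, \<sigma> \<union> \<tau>)}"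
    then show "\<tau> = \<sigma>\<^sub>X" using nonempty uniq by blast
  qed
  moreover have "reach A w (Suc j) \<noteq> {}" using nonempty by blast
  ultimately show "lambdaX X A (reach A w j) (\<sigma>\<^sub>I, \<sigma>) = Some \<sigma>\<^sub>X"
    unfolding lambdaX_def delta prod.case by simp
qed

text \<open>There is no feedback from \<open>TX\<close> to \<open>TY\<close>, so the composed run
  splits into the run of \<open>TY\<close> and the run of \<open>TX\<close> on the word that
  \<open>TY\<close> produces.\<close>

lemma td_run_compose_td:
  "td_run (compose_td Ou TY TX) \<alpha> j = (td_run TY \<alpha> j, td_run TX (td_word TY \<alpha>) j)"
  by (induction j) (auto simp: compose_td_def td_word_def)

theorem theorem3:
  fixes I Ou X :: "'v set"
    and \<phi> :: "'v ltl"
    and A A' :: "('v set \<times> 'v set, 'q) nba"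
    and TY :: "('v set, 'v set, 's) transducer"
    and TX :: "('v set \<times> 'v set, 'v set option, 'q set) transducer"
    and T :: "('v set, 'v set option, 's \<times> 'q set) transducer"
  assumes "finite I" and "finite Ou" and "I \<inter> Ou = {}"
    and "set_ltl \<phi> \<subseteq> I \<union> Ou"
    and "realizable I Ou \<phi>"
    and "wf_nba A" and "nba_alph A = Pow I \<times> Pow Ou"
    and "nba_lang A = ltl_lang I Ou \<phi>"
    and "trim_nba A"
    and "maximal_dependent I Ou \<phi> X"
    and "A' = project_nba I Ou X A"
    and "wf_transducer TY" and "td_in TY = Pow I" and "td_out TY = Pow (Ou - X)"
    and "realizes TY (nba_lang A')"
    and "TX = transducerX I Ou X A"
    and "T = compose_td Ou TY TX"
  shows "realizes T (without_bot (ltl_lang I Ou \<phi>))"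
proof -
  have X: "X \<subseteq> Ou" "dependent_in I Ou \<phi> X"
    using \<open>maximal_dependent I Ou \<phi> X\<close> by (auto simp: maximal_dependent_def)
  have "td_word T \<alpha> \<in> without_bot (ltl_lang I Ou \<phi>)" if \<alpha>: "range \<alpha> \<subseteq> td_in T" for \<alpha>
  proof -
    define u where "u = td_word TY \<alpha>"
    have "range \<alpha> \<subseteq> td_in TY"
      using \<alpha> \<open>T = compose_td Ou TY TX\<close> by (simp add: compose_td_def)
    then have u: "u \<in> nba_lang (project_nba I Ou X A)"
      using \<open>realizes TY (nba_lang A')\<close> \<open>A' = project_nba I Ou X A\<close>
      by (simp add: realizes_def u_def)
    then obtain x where x: "\<And>j. x j \<subseteq> X"
      and w: "(\<lambda>j. (fst (u j), snd (u j) \<union> x j)) \<in> nba_lang A"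
      by (rule project_nba_lift[OF _ \<open>nba_alph A = Pow I \<times> Pow Ou\<close> X(1)]) blast
    define w where "w = (\<lambda>j. (fst (u j), snd (u j) \<union> x j))"
    have "u j \<in> Pow I \<times> Pow (Ou - X)" for j
      using u by (auto simp: nba_lang_def accepting_run_def project_nba_def)
    then have sub: "fst (u j) \<subseteq> I" "snd (u j) \<subseteq> Ou - X" for j
      by (auto simp: mem_Times_iff)
    have step: "deltaX X A (reach A w j) (u j) = reach A w (Suc j)"
      "lambdaX X A (reach A w j) (u j) = Some (x j)" for j
      using transducerX_step[OF \<open>wf_nba A\<close> \<open>trim_nba A\<close> \<open>nba_alph A = Pow I \<times> Pow Ou\<close>
          \<open>nba_lang A = ltl_lang I Ou \<phi>\<close> X(2,1) \<open>I \<inter> Ou = {}\<close>,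
          of w j "fst (u j)" "snd (u j)" "x j"] w sub x
      by (simp_all add: w_def)
    \<comment> \<open>Although \<open>TX\<close> reads only \<open>u\<close>, its state is the
      subset reached on the lifted word \<open>w\<close>.\<close>
    have run: "td_run TX u j = reach A w j" for j
      by (induction j) (simp_all add: \<open>TX = transducerX I Ou X A\<close> transducerX_def step(1) del: reach.simps(2))
    have "td_word T \<alpha> j = map_prod id Some (w j)" for j
    proof -
      have "td_lambda TX (td_run TX u j) (u j) = Some (x j)"
        by (simp add: run step(2)) (simp add: \<open>TX = transducerX I Ou X A\<close> transducerX_def step(2))
      then show ?thesis
        unfolding \<open>T = compose_td Ou TY TX\<close> td_word_def[of "compose_td Ou TY TX"] td_run_compose_td
        by (simp add: compose_td_def w_def u_def td_word_def)
    qed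
    \<comment> \<open>Every output is a \<open>Some\<close> value, so \<open>w\<close> itself is the
      preimage required by \<open>without_bot\<close>.\<close>
    then have "td_word T \<alpha> = map_prod id Some \<circ> w" by auto
    then show ?thesis
      using w \<open>nba_lang A = ltl_lang I Ou \<phi>\<close> by (auto simp: without_bot_def w_def)
  qed
  then show ?thesis by (simp add: realizes_def)
qed

end
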